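(* Every consistent essentially finite $\Gamma\subseteq BN(C)$ has a Leibniz model, i.e. to each such $\Gamma$ a Leibniz model of $\Gamma$ may be assigned.
   Context: Fix a set $C$ of constants with at least three elements. $BN(C)$ is the set of all strings (basic sentences) $Yab$ with $Y\in\{A,E,I,O\}$, $a,b\in C$ ($a=b$ allowed). Contradictories: $\widehat{Aab}=Oab$, $\widehat{Oab}=Aab$, $\widehat{Eab}=Iab$, $\widehat{Iab}=Eab$. The $d$-rules (for all $a,b,c\in C$): (A-Id) infer $Aaa$ from no premises; (Apc) from $Aab$ infer $Iba$; (Ec) from $Eab$ infer $Eba$; (Barbara) from $Aab,Abc$ infer $Aac$; (Celarent) from $Aab,Ebc$ infer $Eac$. For $\Gamma\subseteq BN(C)$, $\Gamma\vdash^{d}\sigma$ means that there is a finite nonempty sequence of basic sentences ending in $\sigma$, each of whose terms is in $\Gamma$ or is the conclusion of a $d$-rule instance whose premises are earlier terms. $\Gamma$ is inconsistent if $\Gamma\vdash^{d}\sigma$ and $\Gamma\vdash^{d}\widehat\sigma$ for some $\sigma\in BN(C)$, and consistent otherwise. $C_\Gamma$ is the set of $c\in C$ that occur in some element of $\Gamma$ having two distinct constants; $\Gamma$ is essentially finite if $C_\Gamma$ is finite. Leibniz models: let $\mathbb{N}$ be the natural numbers including $0$, and $m\,\eta\,n$ mean that $m$ is a multiple of $n$ (so $0\,\eta\,n$ for all $n$). Let $B=\{(m,n)\in\mathbb{N}\times\mathbb{N}:\gcd(m,n)=1\}$ (with $\gcd(0,n)=n$), and let $(m_1,n_1)R(m_2,n_2)$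 iff $m_1\,\eta\,m_2$ and $n_1\,\eta\,n_2$. A Leibniz model is given by a map $\mu:C\to B$; in it $Aab$ is true iff $\mu(a)R\mu(b)$; $Iab$ is true iff there is $x\in B$ with $xR\mu(a)$ and $xR\mu(b)$; $Eab$ is true iff $Iab$ is not; $Oab$ is true iff $Aab$ is not. It is a model of $\Gamma$ if all elements of $\Gamma$ are true in it. *)

theory Defs
  imports "HOL-Library.FuncSet"
begin

text \<open>The four forms of categorical sentence; \<open>Asent a b\<close> is the string \<open>Aab\<close>, and
  likewise for the other letters (a bare \<open>O\<close> is reserved for relational composition).\<close>

datatype (constants_of: 'c) sentence =
    Asent 'c 'c
  | Esent 'c 'c
  | Isent 'c 'c
  | Osent 'c 'c

definition BN :: "'c set \<Rightarrow> 'c sentence set" where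
  "BN C = {\<sigma>. constants_of \<sigma> \<subseteq> C}"

fun contradictory :: "'c sentence \<Rightarrow> 'c sentence" where
  "contradictory (Asent a b) = Osent a b"
| "contradictory (Osent a b) = Asent a b"
| "contradictory (Esent a b) = Isent a b"
| "contradictory (Isent a b) = Esent a b"

text \<open>\<open>d_rule C P \<sigma>\<close>: there is a rule instance over \<open>C\<close> with set of premises \<open>P\<close>
  and conclusion \<open>\<sigma>\<close>.\<close>

inductive d_rule :: "'c set \<Rightarrow> 'c sentence set \<Rightarrow> 'c sentence \<Rightarrow> bool" for C :: "'c set" where
  A_Id: "a \<in> C \<Longrightarrow> d_rule C {} (Asent a a)"
| Apc: "a \<in> C \<Longrightarrow> b \<in> C \<Longrightarrow> d_rule C {Asent a b} (Isent b a)"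
| Ec: "a \<in> C \<Longrightarrow> b \<in> C \<Longrightarrow> d_rule C {Esent a b} (Esent b a)"
| Barbara: "a \<in> C \<Longrightarrow> b \<in> C \<Longrightarrow> c \<in> C \<Longrightarrow> d_rule C {Asent a b, Asent b c} (Asent a c)"
| Celarent: "a \<in> C \<Longrightarrow> b \<in> C \<Longrightarrow> c \<in> C \<Longrightarrow> d_rule C {Asent a b, Esent b c} (Esent a c)"

definition d_derivation :: "'c set \<Rightarrow> 'c sentence set \<Rightarrow> 'c sentence list \<Rightarrow> bool" where
  "d_derivation C \<Gamma> ps \<longleftrightarrow>
     ps \<noteq> [] \<and> set ps \<subseteq> BN C \<and>
     (\<forall>i<length ps. ps ! i \<in> \<Gamma> \<or> (\<exists>P. P \<subseteq> set (take i ps) \<and> d_rule C P (ps ! i)))"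

definition d_derives :: "'c set \<Rightarrow> 'c sentence set \<Rightarrow> 'c sentence \<Rightarrow> bool" where
  "d_derives C \<Gamma> \<sigma> \<longleftrightarrow> (\<exists>ps. d_derivation C \<Gamma> ps \<and> last ps = \<sigma>)"

definition inconsistent :: "'c set \<Rightarrow> 'c sentence set \<Rightarrow> bool" where
  "inconsistent C \<Gamma> \<longleftrightarrow>
     (\<exists>\<sigma>\<in>BN C. d_derives C \<Gamma> \<sigma> \<and> d_derives C \<Gamma> (contradictory \<sigma>))"

definition consistent :: "'c set \<Rightarrow> 'c sentence set \<Rightarrow> bool" where
  "consistent C \<Gamma> \<longleftrightarrow> \<not> inconsistent C \<Gamma>"

text \<open>The set \<open>C\<^sub>\<Gamma>\<close>: sentences such as \<open>Aaa\<close>, with only one constant, do not contribute.\<close>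

definition essential_constants :: "'c set \<Rightarrow> 'c sentence set \<Rightarrow> 'c set" where
  "essential_constants C \<Gamma> = {c \<in> C. \<exists>\<sigma>\<in>\<Gamma>. c \<in> constants_of \<sigma> \<and> card (constants_of \<sigma>) = 2}"

definition essentially_finite :: "'c set \<Rightarrow> 'c sentence set \<Rightarrow> bool" where
  "essentially_finite C \<Gamma> \<longleftrightarrow> finite (essential_constants C \<Gamma>)"

definition leibniz_B :: "(nat \<times> nat) set" where
  "leibniz_B = {(m, n). gcd m n = 1}"

text \<open>\<open>m \<eta> n\<close> says that \<open>m\<close> is a multiple of \<open>n\<close>, hence the reversed order in \<open>n dvd m\<close>.\<close>

fun leibniz_R :: "nat \<times> nat \<Rightarrow> nat \<times> nat \<Rightarrow> bool" where
  "leibniz_R (m1, n1) (m2, n2) \<longleftrightarrow> m2 dvd m1 \<and> n2 dvd n1"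

fun leibniz_true :: "('c \<Rightarrow> nat \<times> nat) \<Rightarrow> 'c sentence \<Rightarrow> bool" where
  "leibniz_true \<mu> (Asent a b) \<longleftrightarrow> leibniz_R (\<mu> a) (\<mu> b)"
| "leibniz_true \<mu> (Isent a b) \<longleftrightarrow> (\<exists>x\<in>leibniz_B. leibniz_R x (\<mu> a) \<and> leibniz_R x (\<mu> b))"
| "leibniz_true \<mu> (Esent a b) \<longleftrightarrow> \<not> (\<exists>x\<in>leibniz_B. leibniz_R x (\<mu> a) \<and> leibniz_R x (\<mu> b))"
| "leibniz_true \<mu> (Osent a b) \<longleftrightarrow> \<not> leibniz_R (\<mu> a) (\<mu> b)"

text \<open>Values of \<open>\<mu>\<close> outside \<open>C\<close> are unconstrained and play no role when \<open>\<Gamma> \<subseteq> BN C\<close>.\<close>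

definition leibniz_model_of ::
    "'c set \<Rightarrow> ('c \<Rightarrow> nat \<times> nat) \<Rightarrow> 'c sentence set \<Rightarrow> bool" where
  "leibniz_model_of C \<mu> \<Gamma> \<longleftrightarrow> \<mu> \<in> C \<rightarrow> leibniz_B \<and> (\<forall>\<sigma>\<in>\<Gamma>. leibniz_true \<mu> \<sigma>)"

end

(*
Attach a distinct prime to each of the finitely many essential constants.  Let mu(a) = (m, n), where
m is the product of the primes of those c for which Aac is derivable and n is the product of the
primes of those c for which Eac is derivable.  A common prime of c in the first component of mu(a)
and the second component of mu(b) means that Aac and Ebc are derivable, hence Eab is derivable by
(Ec) and Celarent.  With a = b this contradicts Iaa, so mu(a) lies in B, and with Iab in Gamma it is
again a contradiction.
*)

theory Submission
  imports Defs "HOL-Computational_Algebra.Primes"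
begin

text \<open>A term of \<open>qs\<close> cites only earlier terms of \<open>qs\<close>, and these
  stay earlier once \<open>ps\<close> is put in front.\<close>

lemma d_derivation_append:
  assumes "d_derivation C \<Gamma> ps" "d_derivation C \<Gamma> qs"
  shows "d_derivation C \<Gamma> (ps @ qs)"
proof -
  have "(ps @ qs) ! i \<in> \<Gamma> \<or> (\<exists>P. P \<subseteq> set (take i (ps @ qs)) \<and> d_rule C P ((ps @ qs) ! i))"
    if "i < length (ps @ qs)" for i
  proof (cases "i < length ps")
    case True
    then show ?thesis
      using assms(1) by (simp add: d_derivation_def nth_append)
  next
    case False
    then have "i - length ps < length qs"
      using that by auto
    then have "qs ! (i - length ps) \<in> \<Gamma> \<or>
        (\<exists>P. P \<subseteq> set (take (i - length ps) qs) \<and> d_rule C P (qs ! (i - length ps)))"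
      using assms(2) unfolding d_derivation_def by blast
    then show ?thesis
      using False by (auto simp: nth_append)
  qed
  then show ?thesis
    using assms by (auto simp: d_derivation_def)
qed

lemma d_derivation_snoc:
  assumes "ps = [] \<or> d_derivation C \<Gamma> ps" "\<sigma> \<in> BN C"
    and "\<sigma> \<in> \<Gamma> \<or> (\<exists>P. P \<subseteq> set ps \<and> d_rule C P \<sigma>)"
  shows "d_derivation C \<Gamma> (ps @ [\<sigma>])"
  using assms unfolding d_derivation_def
  by (auto simp: nth_append less_Suc_eq)

lemma d_derives_premise:
  assumes "\<sigma> \<in> \<Gamma>" "\<sigma> \<in> BN C"
  shows "d_derives C \<Gamma> \<sigma>"
  using d_derivation_snoc[of "[]" C \<Gamma> \<sigma>] assms
  unfolding d_derives_def by fastforce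

lemma d_rule_conclusion_in_BN: "d_rule C P \<sigma> \<Longrightarrow> \<sigma> \<in> BN C"
  by (auto simp: BN_def elim: d_rule.cases)

lemma finite_d_rule_premises: "d_rule C P \<sigma> \<Longrightarrow> finite P"
  by (auto elim: d_rule.cases)

text \<open>Closure of derivability under the rules, so that lists need not be handled again:
  derivations of the finitely many premises are concatenated and \<open>\<sigma>\<close> is
  appended.\<close>

lemma d_derives_rule:
  assumes "d_rule C P \<sigma>" "\<And>\<rho>. \<rho> \<in> P \<Longrightarrow> d_derives C \<Gamma> \<rho>"
  shows "d_derives C \<Gamma> \<sigma>"
proof -
  have "\<exists>ps. (ps = [] \<or> d_derivation C \<Gamma> ps) \<and> P \<subseteq> set ps"
    using finite_d_rule_premises[OF assms(1)] assms(2)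
  proof (induction P rule: finite_induct)
    case empty
    then show ?case by auto
  next
    case (insert \<rho> P)
    then obtain ps where ps: "ps = [] \<or> d_derivation C \<Gamma> ps" "P \<subseteq> set ps"
      by auto
    obtain qs where qs: "d_derivation C \<Gamma> qs" "last qs = \<rho>"
      using insert.prems unfolding d_derives_def by auto
    then have "\<rho> \<in> set qs"
      unfolding d_derivation_def by auto
    with ps qs(1) show ?case
      by (intro exI[of _ "ps @ qs"]) (auto intro: d_derivation_append)
  qed
  then show ?thesis
    using d_derivation_snoc d_rule_conclusion_in_BN[OF assms(1)] assms(1)
    unfolding d_derives_def by (metis last_snoc)
qed

lemma d_derives_A_Id: "a \<in> C \<Longrightarrow> d_derives C \<Gamma> (Asent a a)"
  by (rule d_derives_rule[OF A_Id]) auto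

lemma d_derives_Apc:
  "a \<in> C \<Longrightarrow> b \<in> C \<Longrightarrow> d_derives C \<Gamma> (Asent a b) \<Longrightarrow> d_derives C \<Gamma> (Isent b a)"
  by (rule d_derives_rule[OF Apc]) auto

lemma d_derives_Ec:
  "a \<in> C \<Longrightarrow> b \<in> C \<Longrightarrow> d_derives C \<Gamma> (Esent a b) \<Longrightarrow> d_derives C \<Gamma> (Esent b a)"
  by (rule d_derives_rule[OF Ec]) auto

lemma d_derives_Barbara:
  "a \<in> C \<Longrightarrow> b \<in> C \<Longrightarrow> c \<in> C \<Longrightarrow> d_derives C \<Gamma> (Asent a b) \<Longrightarrow> d_derives C \<Gamma> (Asent b c)
    \<Longrightarrow> d_derives C \<Gamma> (Asent a c)"
  by (rule d_derives_rule[OF Barbara[of a C b c]]) auto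

lemma d_derives_Celarent:
  "a \<in> C \<Longrightarrow> b \<in> C \<Longrightarrow> c \<in> C \<Longrightarrow> d_derives C \<Gamma> (Asent a b) \<Longrightarrow> d_derives C \<Gamma> (Esent b c)
    \<Longrightarrow> d_derives C \<Gamma> (Esent a c)"
  by (rule d_derives_rule[OF Celarent[of a C b c]]) auto

lemma consistent_not_A_O:
  "consistent C \<Gamma> \<Longrightarrow> a \<in> C \<Longrightarrow> b \<in> C \<Longrightarrow> d_derives C \<Gamma> (Asent a b)
    \<Longrightarrow> \<not> d_derives C \<Gamma> (Osent a b)"
  unfolding consistent_def inconsistent_def
  by (force simp: BN_def dest: bspec[of _ _ "Asent a b"])

lemma consistent_not_E_I:
  "consistent C \<Gamma> \<Longrightarrow> a \<in> C \<Longrightarrow> b \<in> C \<Longrightarrow> d_derives C \<Gamma> (Esent a b)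
    \<Longrightarrow> \<not> d_derives C \<Gamma> (Isent a b)"
  unfolding consistent_def inconsistent_def
  by (force simp: BN_def dest: bspec[of _ _ "Esent a b"])

lemma ex_inj_on_primes:
  assumes "finite D"
  shows "\<exists>p :: 'a \<Rightarrow> nat. inj_on p D \<and> (\<forall>c\<in>D. prime (p c))"
proof -
  obtain P :: "nat set" where P: "finite P" "card P = card D" "P \<subseteq> {q. prime q}"
    using infinite_arbitrarily_large[OF primes_infinite] by blast
  obtain p where "bij_betw p D P"
    using finite_same_card_bij[OF assms P(1)] P(2) by auto
  with P(3) show ?thesis
    by (auto simp: bij_betw_def)
qed

text \<open>A prime dividing the product divides some factor \<open>p d\<close>, hence equals it,
  and injectivity gives \<open>c = d\<close>. The product therefore determines
  \<open>S\<close>.\<close>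

lemma prime_dvd_prod_inj_iff:
  fixes p :: "'a \<Rightarrow> nat"
  assumes "finite D" "inj_on p D" "\<And>c. c \<in> D \<Longrightarrow> prime (p c)" "S \<subseteq> D" "c \<in> D"
  shows "p c dvd prod p S \<longleftrightarrow> c \<in> S"
proof
  have fin: "finite S"
    using assms(1,4) by (rule rev_finite_subset)
  assume "p c dvd prod p S"
  then obtain d where d: "d \<in> S" "p c dvd p d"
    using prime_dvd_prod_iff[OF fin, of "p c" p] assms(3,5) by auto
  then have "p c = p d"
    using assms(3,4,5) by (meson primes_dvd_imp_eq subsetD)
  then show "c \<in> S"
    using d assms(2,4,5) by (metis inj_onD subsetD)
next
  assume "c \<in> S"
  then show "p c dvd prod p S"
    using assms(1,4) by (meson dvd_prodI finite_subset)
qed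

text \<open>By injectivity on \<open>D\<close>, disjoint index sets contribute distinct, hence
  coprime, primes.\<close>

lemma coprime_prod_disjoint:
  fixes p :: "'a \<Rightarrow> nat"
  assumes "inj_on p D" "\<And>c. c \<in> D \<Longrightarrow> prime (p c)" "S \<subseteq> D" "T \<subseteq> D" "S \<inter> T = {}"
  shows "coprime (prod p S) (prod p T)"
proof (intro prod_coprime_left prod_coprime_right)
  fix c d
  assume "c \<in> S" "d \<in> T"
  with assms show "coprime (p c) (p d)"
    by (metis disjoint_iff inj_onD primes_coprime subsetD)
qed

text \<open>Ensures that the constants of an E or O sentence in \<open>\<Gamma>\<close> have primes
  of their own.\<close>

lemma essential_constantsI:
  assumes "\<sigma> \<in> \<Gamma>" "constants_of \<sigma> = {a, b}" "a \<noteq> b" "a \<in> C" "b \<in> C"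
  shows "a \<in> essential_constants C \<Gamma>" "b \<in> essential_constants C \<Gamma>"
  using assms unfolding essential_constants_def by (auto intro!: bexI[of _ \<sigma>])

theorem theorem2p13:
  fixes C :: "'c set" and \<Gamma> :: "'c sentence set"
  assumes "infinite C \<or> card C \<ge> 3"
    and "\<Gamma> \<subseteq> BN C"
    and "consistent C \<Gamma>"
    and "essentially_finite C \<Gamma>"
  shows "\<exists>\<mu>. leibniz_model_of C \<mu> \<Gamma>"
proof -
  define D where "D = essential_constants C \<Gamma>"
  have D: "finite D" and DC: "D \<subseteq> C"
    using assms(4) by (auto simp: D_def essentially_finite_def essential_constants_def)
  obtain p :: "'c \<Rightarrow> nat" where p: "inj_on p D" "\<And>c. c \<in> D \<Longrightarrow> prime (p c)"
    using ex_inj_on_primes[OF D] by blast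
  \<comment> \<open>Restricting \<open>c\<close> to \<open>D\<close> keeps both products finite even
    when \<open>C\<close> is infinite.\<close>
  define S where "S a = {c \<in> D. d_derives C \<Gamma> (Asent a c)}" for a
  define T where "T a = {c \<in> D. d_derives C \<Gamma> (Esent a c)}" for a
  have SD: "S a \<subseteq> D" and TD: "T a \<subseteq> D" and fin: "finite (S a)" "finite (T a)" for a
    using D by (auto simp: S_def T_def)
  define \<mu> where "\<mu> a = (prod p (S a), prod p (T a))" for a
  have in_\<Gamma>: "d_derives C \<Gamma> \<sigma>" if "\<sigma> \<in> \<Gamma>" for \<sigma>
    using that assms(2) by (intro d_derives_premise) auto
  have I_self: "d_derives C \<Gamma> (Isent a a)" if "a \<in> C" for a
    using that by (simp add: d_derives_A_Id d_derives_Apc)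
  \<comment> \<open>Used with \<open>a = b\<close> for membership in \<open>leibniz_B\<close>, and
    with distinct constants for the I sentences of \<open>\<Gamma>\<close>.\<close>
  have disj: "S a \<inter> T b = {}" if "a \<in> C" "b \<in> C" "d_derives C \<Gamma> (Isent a b)" for a b
  proof (rule ccontr)
    assume "S a \<inter> T b \<noteq> {}"
    then obtain c where c: "c \<in> C" "d_derives C \<Gamma> (Asent a c)" "d_derives C \<Gamma> (Esent b c)"
      using DC by (auto simp: S_def T_def)
    then have "d_derives C \<Gamma> (Esent a b)"
      using that by (meson d_derives_Ec d_derives_Celarent)
    with that consistent_not_E_I[OF assms(3)] show False
      by blast
  qed
  have "\<mu> a \<in> leibniz_B" if "a \<in> C" for a
    using coprime_prod_disjoint[OF p SD TD] disj[OF that that I_self[OF that]]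
    by (simp add: \<mu>_def leibniz_B_def coprime_iff_gcd_eq_1)
  moreover have "leibniz_true \<mu> \<sigma>" if \<sigma>: "\<sigma> \<in> \<Gamma>" for \<sigma>
  proof (cases \<sigma>)
    case (Asent a b)
    then have ab: "a \<in> C" "b \<in> C" "d_derives C \<Gamma> (Asent a b)"
      using \<sigma> assms(2) in_\<Gamma> by (auto simp: BN_def)
    \<comment> \<open>Prefixing \<open>Asent a b\<close> by Barbara or Celarent carries whatever is
      derived for \<open>b\<close> over to \<open>a\<close>; inclusion of index sets then yields
      divisibility of both components.\<close>
    have "S b \<subseteq> S a"
      using ab DC by (auto simp: S_def intro: d_derives_Barbara[of a C b])
    moreover have "T b \<subseteq> T a"
      using ab DC by (auto simp: T_def intro: d_derives_Celarent[of a C b])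
    ultimately show ?thesis
      using fin Asent by (simp add: \<mu>_def prod_dvd_prod_subset)
  next
    case (Esent a b)
    then have ab: "a \<in> C" "b \<in> C" "d_derives C \<Gamma> (Esent a b)"
      using \<sigma> assms(2) in_\<Gamma> by (auto simp: BN_def)
    \<comment> \<open>Needed for \<open>a\<close> to have a prime: a sentence with a single constant
      adds nothing to \<open>D\<close>.\<close>
    have "a \<noteq> b"
      using ab I_self consistent_not_E_I[OF assms(3)] by blast
    then have "a \<in> D"
      using essential_constantsI(1)[OF \<sigma>] Esent ab by (auto simp: D_def)
    \<comment> \<open>The prime of \<open>a\<close> itself separates the two values: it enters the
      first component of \<open>\<mu> a\<close> by A-Id and the second of \<open>\<mu> b\<close> by
      Ec, so it would divide both components of any common \<open>x\<close>.\<close>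
    then have "a \<in> S a" "a \<in> T b"
      using ab by (auto simp: S_def T_def d_derives_A_Id d_derives_Ec)
    then have pa: "p a dvd prod p (S a)" "p a dvd prod p (T b)"
      using fin by auto
    have "\<not> (\<exists>x\<in>leibniz_B. leibniz_R x (\<mu> a) \<and> leibniz_R x (\<mu> b))"
    proof
      assume "\<exists>x\<in>leibniz_B. leibniz_R x (\<mu> a) \<and> leibniz_R x (\<mu> b)"
      then obtain m n where mn: "gcd m n = 1" "prod p (S a) dvd m" "prod p (T b) dvd n"
        by (auto simp: \<mu>_def leibniz_B_def)
      have "p a dvd gcd m n"
        using dvd_trans[OF pa(1) mn(2)] dvd_trans[OF pa(2) mn(3)] by (rule gcd_greatest)
      then show False
        using mn(1) p(2)[OF \<open>a \<in> D\<close>] by auto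
    qed
    then show ?thesis
      using Esent by simp
  next
    case (Isent a b)
    then have ab: "a \<in> C" "b \<in> C" "d_derives C \<Gamma> (Isent a b)"
      using \<sigma> assms(2) in_\<Gamma> by (auto simp: BN_def)
    \<comment> \<open>Products over the unions are common multiples of the respective components;
      \<open>x\<close> lies in \<open>leibniz_B\<close> once four intersections are empty.\<close>
    define x where "x = (prod p (S a \<union> S b), prod p (T a \<union> T b))"
    \<comment> \<open>The rules do not convert \<open>Isent a b\<close> to \<open>Isent b a\<close>,
      so \<open>disj\<close> cannot simply be applied with \<open>a\<close> and \<open>b\<close>
      exchanged. The conversion is made on the E side instead.\<close>
    have "S b \<inter> T a = {}"
    proof (rule ccontr)
      assume "S b \<inter> T a \<noteq> {}"
      then obtain c where c: "c \<in> C" "d_derives C \<Gamma> (Asent b c)" "d_derives C \<Gamma> (Esent a c)"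
        using DC by (auto simp: S_def T_def)
      then have "d_derives C \<Gamma> (Esent a b)"
        using ab by (meson d_derives_Ec d_derives_Celarent)
      with ab consistent_not_E_I[OF assms(3)] show False
        by blast
    qed
    then have "(S a \<union> S b) \<inter> (T a \<union> T b) = {}"
      using disj[OF ab] disj[OF _ _ I_self] ab by blast
    then have "x \<in> leibniz_B"
      using coprime_prod_disjoint[OF p, of "S a \<union> S b" "T a \<union> T b"] SD TD
      by (simp add: x_def leibniz_B_def coprime_iff_gcd_eq_1)
    moreover have "leibniz_R x (\<mu> a)" "leibniz_R x (\<mu> b)"
      using fin by (auto simp: x_def \<mu>_def intro: prod_dvd_prod_subset)
    ultimately show ?thesis
      using Isent by auto
  next
    case (Osent a b)
    then have ab: "a \<in> C" "b \<in> C" "d_derives C \<Gamma> (Osent a b)"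
      using \<sigma> assms(2) in_\<Gamma> by (auto simp: BN_def)
    then have not_A: "\<not> d_derives C \<Gamma> (Asent a b)"
      using consistent_not_A_O[OF assms(3)] by metis
    then have "a \<noteq> b"
      using d_derives_A_Id[OF ab(1)] by metis
    then have b: "b \<in> D"
      using essential_constantsI(2)[OF \<sigma>] Osent ab by (auto simp: D_def)
    \<comment> \<open>The prime of \<open>b\<close> is the witness: it divides the first component
      of \<open>\<mu> b\<close> but not that of \<open>\<mu> a\<close>.\<close>
    then have "b \<in> S b" "b \<notin> S a"
      using ab not_A by (simp_all add: S_def d_derives_A_Id)
    then have "p b dvd prod p (S b)" "\<not> p b dvd prod p (S a)"
      using prime_dvd_prod_inj_iff[OF D p SD b] by simp_all
    then have "\<not> prod p (S b) dvd prod p (S a)"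
      using dvd_trans by blast
    then show ?thesis
      using Osent by (simp add: \<mu>_def)
  qed
  ultimately show ?thesis
    unfolding leibniz_model_of_def by blast
qed

end
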